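(* Assume that $A \in M_{n\times n}(\mathbb{R})$, $C \in K(\mathbb{R}^n)$, and let $u_C(A), v_C(A)\in C$ be right and left quasi-eigenvectors of $A$ in $C$. (a) If $v_C(A)\in C^o$, then $$\overline{\lambda}_{C}(A+D)-\underline{\lambda}_{C}(A)\leq c_1(A,C)\|D\|_M\quad \forall D \in M_{n\times n}(\mathbb{R});$$ moreover, if $D\le 0$, then $\overline{\lambda}_{C}(A+D)\leq \underline{\lambda}_{C}(A)$. (b) If $u_C(A)\in C^o$, then $$\underline{\lambda}_{C}(A+D)-\overline{\lambda}_{C}(A)\geq -c_2(A,C)\|D\|_M\quad \forall D \in M_{n\times n}(\mathbb{R});$$ moreover, if $D\ge 0$, then $\underline{\lambda}_{C}(A+D)\geq \overline{\lambda}_{C}(A)$. Here $$c_1(A,C)=\sup_{u \in C}\frac{\| u\| }{\langle u, v_{C}(A)\rangle},\qquad c_2(A,C)=\sup_{v \in C}\frac{\| v\| }{\langle u_{C}(A), v \rangle}<+\infty .$$ (c) In particular, if $u_C(A),v_C(A)\in C^o$, then for all $D \in M_{n\times n}(\mathbb{R})$ $$|\overline{\lambda}_{C}(A+D)-\lambda_{C}(A)|\leq c_0(A,C) \|D\|_M,\qquad |\underline{\lambda}_{C}(A+D)-\lambda_{C}(A)|\leq c_0(A,C) \|D\|_M,$$ where $c_0(A,C):=\max\{c_1(A,C),c_2(A,C)\}$.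
   Context: $M_{n\times n}(\mathbb{R})$ is the space of real $n\times n$ matrices with the standard operator norm $\|\cdot\|_M$; $\langle\cdot,\cdot\rangle$ is the inner product on $\mathbb{R}^n$ and $\|\cdot\|$ the corresponding norm. $\overline{K}(\mathbb{R}^n)$ is the set of self-dual solid convex cones in $\mathbb{R}^n$: $\overline{C}\in\overline{K}(\mathbb{R}^n)$ if $\alpha u+\beta w\in\overline{C}$ for all $u,w\in\overline{C}$ and $\alpha,\beta\ge 0$; $\overline{C}=\{u\in\mathbb{R}^n\mid \langle w,u\rangle\ge 0\ \forall w\in\overline{C}\}$; and $C^o:=\operatorname{int}\overline{C}\ne\emptyset$. Put $C:=\overline{C}\setminus\{0\}$ and $K(\mathbb{R}^n):=\{C\mid \overline{C}\in\overline{K}(\mathbb{R}^n)\}$. For a matrix $B$, write $\lambda_B(u,v):=\frac{\langle Bu,v\rangle}{\langle u,v\rangle}$ (well defined on $C\times C^o$ and $C^o\times C$), and define the upper and lower quasi-eigenvalues $\overline{\lambda}_C(B):=\sup_{u\in C}\inf_{v\in C^o}\lambda_B(u,v)$ and $\underline{\lambda}_C(B):=\inf_{v\in C}\sup_{u\in C^o}\lambda_B(u,v)$. A right quasi-eigenvector of $A$ in $C$ is a vector $u_C(A)\in C$ with $\overline{\lambda}_C(A)=\inf_{v\in C^o}\lambda_A(u_C(A),v)$; a left quasi-eigenvector is a vector $v_C(A)\in C$ with $\underline{\lambda}_C(A)=\sup_{u\in C^o}\lambda_A(u,v_C(A))$ (such vectors always exist). When $u_C(A),v_C(A)\in C^o$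 one has $\overline{\lambda}_C(A)=\underline{\lambda}_C(A)$, and $\lambda_C(A)$ denotes this common value. $D\ge 0$ (respectively $D\le 0$) means that all entries of $D$ are nonnegative (respectively nonpositive).
   Formalization: Quasi-eigenvectors u_C(A), v_C(A) are assumed to have norm 1 (the bounds fail under rescaling); D≤0, D≥0 is entrywise only for the positive orthant, and for general C is replaced by ⟨Du,v⟩≤0 (≥0) for all u,v in C, since the entrywise claim fails. *)

theory Defs
  imports "HOL-Analysis.Analysis"
begin

definition self_dual_solid_cone :: "(real ^ 'n) set \<Rightarrow> bool" where
  "self_dual_solid_cone K \<longleftrightarrow>
     (\<forall>u\<in>K. \<forall>w\<in>K. \<forall>\<alpha>\<ge>0. \<forall>\<beta>\<ge>0. \<alpha> *\<^sub>R u + \<beta> *\<^sub>R w \<in> K) \<and>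
     K = {u. \<forall>w\<in>K. 0 \<le> w \<bullet> u} \<and>
     interior K \<noteq> {}"

definition punctured_cones :: "(real ^ 'n) set set" where
  "punctured_cones = {K - {0} | K. self_dual_solid_cone K}"

text \<open>The members \<open>C\<close> of \<^const>\<open>punctured_cones\<close> have the origin removed; \<open>insert 0 C\<close>
  recovers the closed cone, and its interior is what is usually written \<open>C\<close> with a superscript o.\<close>

definition cone_interior :: "(real ^ 'n) set \<Rightarrow> (real ^ 'n) set" where
  "cone_interior C = interior (insert 0 C)"

definition quasi_quotient :: "real ^ 'n ^ 'n \<Rightarrow> real ^ 'n \<Rightarrow> real ^ 'n \<Rightarrow> real" where
  "quasi_quotient B u v = ((B *v u) \<bullet> v) / (u \<bullet> v)"

text \<open>The inner infimum (supremum) can be infinite when \<open>u\<close> (\<open>v\<close>) lies on the boundary of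
  the cone, hence \<^typ>\<open>ereal\<close>. The resulting quasi-eigenvalues of a cone in
  \<^const>\<open>punctured_cones\<close> are always finite.\<close>

definition upper_quasi_eigenvalue :: "(real ^ 'n) set \<Rightarrow> real ^ 'n ^ 'n \<Rightarrow> ereal" where
  "upper_quasi_eigenvalue C B =
     (SUP u\<in>C. INF v\<in>cone_interior C. ereal (quasi_quotient B u v))"

definition lower_quasi_eigenvalue :: "(real ^ 'n) set \<Rightarrow> real ^ 'n ^ 'n \<Rightarrow> ereal" where
  "lower_quasi_eigenvalue C B =
     (INF v\<in>C. SUP u\<in>cone_interior C. ereal (quasi_quotient B u v))"

text \<open>Only meaningful when the upper and lower quasi-eigenvalues coincide.\<close>

definition quasi_eigenvalue :: "(real ^ 'n) set \<Rightarrow> real ^ 'n ^ 'n \<Rightarrow> ereal" where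
  "quasi_eigenvalue C B =
     (THE l. l = upper_quasi_eigenvalue C B \<and> l = lower_quasi_eigenvalue C B)"

definition right_quasi_eigenvector ::
    "(real ^ 'n) set \<Rightarrow> real ^ 'n ^ 'n \<Rightarrow> real ^ 'n \<Rightarrow> bool" where
  "right_quasi_eigenvector C A u \<longleftrightarrow>
     u \<in> C \<and>
     upper_quasi_eigenvalue C A = (INF v\<in>cone_interior C. ereal (quasi_quotient A u v))"

definition left_quasi_eigenvector ::
    "(real ^ 'n) set \<Rightarrow> real ^ 'n ^ 'n \<Rightarrow> real ^ 'n \<Rightarrow> bool" where
  "left_quasi_eigenvector C A v \<longleftrightarrow>
     v \<in> C \<and>
     lower_quasi_eigenvalue C A = (SUP u\<in>cone_interior C. ereal (quasi_quotient A u v))"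

text \<open>The stability constants depend on the matrix only through the chosen quasi-eigenvector:
  \<open>v\<close> is a left one in \<open>c1\<close>, and \<open>u\<close> a right one in \<open>c2\<close>. They are used only when that vector is
  interior, so that the denominators are positive. They are homogeneous of degree -1 in it, so a
  bound by \<open>c1\<close> or \<open>c2\<close> presupposes a normalised quasi-eigenvector.\<close>

definition c1 :: "(real ^ 'n) set \<Rightarrow> real ^ 'n \<Rightarrow> ereal" where
  "c1 C v = (SUP u\<in>C. ereal (norm u / (u \<bullet> v)))"

definition c2 :: "(real ^ 'n) set \<Rightarrow> real ^ 'n \<Rightarrow> ereal" where
  "c2 C u = (SUP v\<in>C. ereal (norm v / (u \<bullet> v)))"

definition c0 :: "(real ^ 'n) set \<Rightarrow> real ^ 'n \<Rightarrow> real ^ 'n \<Rightarrow> ereal" where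
  "c0 C u v = max (c1 C v) (c2 C u)"

definition entrywise_nonneg :: "real ^ 'n ^ 'n \<Rightarrow> bool" where
  "entrywise_nonneg D \<longleftrightarrow> (\<forall>i j. 0 \<le> D $ i $ j)"

definition entrywise_nonpos :: "real ^ 'n ^ 'n \<Rightarrow> bool" where
  "entrywise_nonpos D \<longleftrightarrow> (\<forall>i j. D $ i $ j \<le> 0)"

definition positive_orthant :: "(real ^ 'n) set" where
  "positive_orthant = {x. \<forall>i. 0 \<le> x $ i} - {0}"

text \<open>The entrywise order is compatible with the quotients only for the positive orthant and its
  negative. For a general cone the order on matrices has to be the one induced by the cone; on the
  orthant the two coincide, as the lemmas below show.\<close>

definition cone_nonneg :: "(real ^ 'n) set \<Rightarrow> real ^ 'n ^ 'n \<Rightarrow> bool" where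
  "cone_nonneg C D \<longleftrightarrow> (\<forall>u\<in>C. \<forall>v\<in>C. 0 \<le> (D *v u) \<bullet> v)"

definition cone_nonpos :: "(real ^ 'n) set \<Rightarrow> real ^ 'n ^ 'n \<Rightarrow> bool" where
  "cone_nonpos C D \<longleftrightarrow> (\<forall>u\<in>C. \<forall>v\<in>C. (D *v u) \<bullet> v \<le> 0)"

lemma cone_nonneg_orthant_iff:
  fixes D :: "real ^ 'n ^ 'n"
  shows "cone_nonneg positive_orthant D \<longleftrightarrow> entrywise_nonneg D"
proof
  assume "cone_nonneg positive_orthant D"
  moreover have "axis i (1::real) \<in> positive_orthant" for i :: 'n
    by (simp add: positive_orthant_def axis_def vec_eq_iff)
  ultimately have "0 \<le> (D *v axis j 1) \<bullet> axis i 1" for i j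
    unfolding cone_nonneg_def by blast
  then show "entrywise_nonneg D"
    by (simp add: entrywise_nonneg_def inner_axis matrix_vector_mult_basis column_def)
next
  assume "entrywise_nonneg D"
  then show "cone_nonneg positive_orthant D"
    unfolding cone_nonneg_def entrywise_nonneg_def positive_orthant_def
    by (auto simp: inner_vec_def matrix_vector_mult_def intro!: sum_nonneg mult_nonneg_nonneg)
qed

lemma cone_nonpos_iff: "cone_nonpos C D \<longleftrightarrow> cone_nonneg C (- D)"
proof -
  have "(- D) *v u = - (D *v u)" for u
    by (simp add: vec_eq_iff matrix_vector_mult_def sum_negf)
  then show ?thesis
    by (simp add: cone_nonpos_def cone_nonneg_def)
qed

lemma cone_nonpos_orthant_iff:
  fixes D :: "real ^ 'n ^ 'n"
  shows "cone_nonpos positive_orthant D \<longleftrightarrow> entrywise_nonpos D"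
  by (simp add: cone_nonpos_iff cone_nonneg_orthant_iff entrywise_nonneg_def entrywise_nonpos_def)

end

theory Submission
  imports Defs
begin

text \<open>If the left quasi-eigenvector \<open>v\<close> is interior, then \<open>\<lambda>\<^sub>B(u, v)\<close> over all \<open>u\<close> in the cone bounds the
  upper quasi-eigenvalue of \<open>B\<close> from above. For \<open>B = A\<close> its supremum is the lower quasi-eigenvalue
  of \<open>A\<close>, by density of the interior, and passing to \<open>A + D\<close> changes the quotient by
  \<open>\<langle>Du, v\<rangle> / \<langle>u, v\<rangle> \<le> \<parallel>D\<parallel> \<parallel>u\<parallel> / \<langle>u, v\<rangle>\<close>. This is (a), and (b) is (a) for the negated transpose, which
  exchanges the two quasi-eigenvalues up to sign. For (c) one needs in addition that the lower
  quasi-eigenvalue never exceeds the upper one: if no \<open>u\<close> in the cone has \<open>(B - r)u\<close> in the closed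
  cone, then separating the image of a compact base from the cone yields \<open>w\<close> in the (self-dual)
  cone with \<open>\<langle>(B - r)u, w\<rangle> < 0\<close> for all \<open>u\<close>.\<close>

section \<open>Geometry of self-dual cones\<close>

text \<open>Self-duality presents the cone as an intersection of closed half-spaces through the
  origin, which yields closedness and membership of 0.\<close>

lemma
  assumes "C \<in> punctured_cones"
  shows cone_self_dual: "u \<in> insert 0 C \<longleftrightarrow> (\<forall>w\<in>insert 0 C. 0 \<le> w \<bullet> u)"
    and cone_interior_nonempty: "cone_interior C \<noteq> {}"
    and cone_zero_notin: "0 \<notin> C"
    and cone_closed: "closed (insert 0 C)"
    and cone_convex: "convex (insert 0 C)"
    and cone_scale: "u \<in> insert 0 C \<Longrightarrow> 0 \<le> a \<Longrightarrow> a *\<^sub>R u \<in> insert 0 C"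
proof -
  obtain K where K: "self_dual_solid_cone K" and C: "C = K - {0}"
    using assms by (auto simp: punctured_cones_def)
  have dual: "K = {u. \<forall>w\<in>K. 0 \<le> w \<bullet> u}"
    and lin: "\<And>u w a b. u \<in> K \<Longrightarrow> w \<in> K \<Longrightarrow> 0 \<le> a \<Longrightarrow> 0 \<le> b \<Longrightarrow> a *\<^sub>R u + b *\<^sub>R w \<in> K"
    and int: "interior K \<noteq> {}"
    using K unfolding self_dual_solid_cone_def by blast+
  have "0 \<in> K" by (subst dual) simp
  then have ins: "insert 0 C = K" using C by auto
  show "u \<in> insert 0 C \<longleftrightarrow> (\<forall>w\<in>insert 0 C. 0 \<le> w \<bullet> u)"
    unfolding ins using dual by blast
  show "cone_interior C \<noteq> {}" unfolding cone_interior_def ins by (rule int)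
  show "0 \<notin> C" using C by simp
  have "closed (\<Inter>w\<in>K. {u. w \<bullet> u \<ge> 0})"
    by (intro closed_INT ballI closed_halfspace_ge)
  moreover have "(\<Inter>w\<in>K. {u. w \<bullet> u \<ge> 0}) = {u. \<forall>w\<in>K. 0 \<le> w \<bullet> u}" by auto
  ultimately show "closed (insert 0 C)" unfolding ins using dual by simp
  show "convex (insert 0 C)" unfolding ins convex_def using lin by blast
  show "a *\<^sub>R u \<in> insert 0 C" if "u \<in> insert 0 C" "0 \<le> a"
    using that lin[of u u a 0] unfolding ins by simp
qed

lemma cone_inner_nonneg:
  assumes "C \<in> punctured_cones" "u \<in> insert 0 C" "w \<in> insert 0 C"
  shows "0 \<le> u \<bullet> w"
  using cone_self_dual[OF assms(1)] assms(2,3) by blast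

text \<open>From an interior \<open>v\<close> one may step a distance \<open>e\<close> in the
  direction of \<open>-u\<close> without leaving the cone, and the point reached still has
  nonnegative inner product with \<open>u\<close>. The constant is uniform in \<open>u\<close>: it
  makes \<open>c1\<close> finite and the slices of the cone bounded.\<close>

lemma interior_inner_bound:
  assumes C: "C \<in> punctured_cones" and v: "v \<in> cone_interior C"
  obtains e where "0 < e" "\<And>u. u \<in> insert 0 C \<Longrightarrow> e * norm u \<le> u \<bullet> v"
proof -
  obtain e where e: "0 < e" "cball v e \<subseteq> insert 0 C"
    using v unfolding cone_interior_def mem_interior_cball by blast
  have "e * norm u \<le> u \<bullet> v" if u: "u \<in> insert 0 C" for u
  proof (cases "u = 0")
    case False
    have "v - (e / norm u) *\<^sub>R u \<in> cball v e"
      using e False by (simp add: dist_norm)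
    then have "0 \<le> u \<bullet> (v - (e / norm u) *\<^sub>R u)"
      using cone_inner_nonneg[OF C u] e(2) by blast
    also have "\<dots> = u \<bullet> v - e * norm u"
      using False by (simp add: inner_diff_right power2_norm_eq_inner[symmetric] power2_eq_square)
    finally show ?thesis by simp
  qed simp
  with e show thesis using that by blast
qed

lemma inner_pos:
  assumes C: "C \<in> punctured_cones" and v: "v \<in> cone_interior C" and u: "u \<in> C"
  shows "0 < u \<bullet> v"
proof -
  obtain e where "0 < e" "e * norm u \<le> u \<bullet> v"
    using interior_inner_bound[OF C v] u by blast
  moreover have "u \<noteq> 0" using cone_zero_notin[OF C] u by blast
  ultimately show ?thesis
    by (metis less_le_trans mult_pos_pos zero_less_norm_iff)
qed

text \<open>The origin is not interior, since otherwise its inner product with a member of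
  \<open>C\<close> would be positive.\<close>

lemma cone_interior_subset:
  assumes C: "C \<in> punctured_cones" and "C \<noteq> {}"
  shows "cone_interior C \<subseteq> C"
proof
  fix v assume v: "v \<in> cone_interior C"
  then have "v \<noteq> 0"
    using inner_pos[OF C v] \<open>C \<noteq> {}\<close> by fastforce
  then show "v \<in> C" using v interior_subset by (auto simp: cone_interior_def)
qed

section \<open>Quotients against a fixed interior vector\<close>

text \<open>Clearing the positive denominator turns the bound into a closed linear condition on
  \<open>u\<close>, and a convex set with nonempty interior lies in the closure of that
  interior.\<close>

lemma quasi_quotient_le_extend:
  assumes C: "C \<in> punctured_cones" "C \<noteq> {}" and v: "v \<in> cone_interior C"
    and le: "\<And>u. u \<in> cone_interior C \<Longrightarrow> quasi_quotient A u v \<le> r" and u: "u \<in> C"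
  shows "quasi_quotient A u v \<le> r"
proof -
  let ?H = "{u. (A *v u) \<bullet> v - r * (u \<bullet> v) \<le> 0}"
  have sub: "cone_interior C \<subseteq> ?H"
  proof
    fix x assume x: "x \<in> cone_interior C"
    then have "0 < x \<bullet> v" using inner_pos[OF C(1) v] cone_interior_subset[OF C] by blast
    then show "x \<in> ?H" using le[OF x] by (simp add: quasi_quotient_def field_simps)
  qed
  have "closed ?H"
    by (intro closed_Collect_le continuous_intros linear_continuous_on
        linear_conv_bounded_linear[THEN iffD1] matrix_vector_mul_linear)
  with sub have "closure (cone_interior C) \<subseteq> ?H" by (simp add: closure_minimal)
  moreover have "u \<in> closure (cone_interior C)"
    using u convex_closure_interior[OF cone_convex[OF C(1)]] closure_subset[of "insert 0 C"]
      cone_interior_nonempty[OF C(1)]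
    unfolding cone_interior_def by blast
  ultimately have "(A *v u) \<bullet> v \<le> r * (u \<bullet> v)" by auto
  then show ?thesis
    using inner_pos[OF C(1) v u] by (simp add: quasi_quotient_def field_simps)
qed

text \<open>The uniform bound gives \<open>1 / e\<close> as an upper bound, and any member of
  \<open>C\<close> keeps the supremum away from -\<infinity>. The real \<open>c\<close> lets later
  estimates be carried out in the reals.\<close>

lemma c1_finite:
  assumes C: "C \<in> punctured_cones" "C \<noteq> {}" and v: "v \<in> cone_interior C"
  obtains c where "c1 C v = ereal c" "0 \<le> c" "\<And>u. u \<in> C \<Longrightarrow> norm u \<le> c * (u \<bullet> v)"
proof -
  obtain e where e: "0 < e" "\<And>u. u \<in> insert 0 C \<Longrightarrow> e * norm u \<le> u \<bullet> v"
    using interior_inner_bound[OF C(1) v] by blast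
  have "norm u / (u \<bullet> v) \<le> 1 / e" if "u \<in> C" for u
    using inner_pos[OF C(1) v that] e that by (simp add: field_simps)
  then have ub: "c1 C v \<le> ereal (1 / e)"
    unfolding c1_def by (intro SUP_least) simp
  have lb: "ereal (norm u / (u \<bullet> v)) \<le> c1 C v" if "u \<in> C" for u
    unfolding c1_def using that by (rule SUP_upper)
  obtain x where x: "x \<in> C" using C(2) by blast
  have nn: "0 \<le> c1 C v"
    using lb[OF x] inner_pos[OF C(1) v x]
    by (metis divide_nonneg_pos ereal_less_eq(5) norm_ge_zero order_trans)
  then obtain c where c: "c1 C v = ereal c"
    using ub by (cases "c1 C v") auto
  have "norm u \<le> c * (u \<bullet> v)" if "u \<in> C" for u
    using lb[OF that] inner_pos[OF C(1) v that] by (simp add: c field_simps)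
  with c nn show thesis using that by simp
qed

lemma quasi_quotient_add: "quasi_quotient (A + D) u v = quasi_quotient A u v + quasi_quotient D u v"
  by (simp add: quasi_quotient_def matrix_vector_mult_add_rdistrib inner_add_left add_divide_distrib)

text \<open>Cauchy-Schwarz removes \<open>v\<close> from the numerator; this is where the
  normalisation of the quasi-eigenvector enters.\<close>

lemma abs_quasi_quotient_le:
  assumes C: "C \<in> punctured_cones" and v: "v \<in> cone_interior C" "norm v = 1" and u: "u \<in> C"
    and c: "norm u \<le> c * (u \<bullet> v)"
  shows "\<bar>quasi_quotient D u v\<bar> \<le> c * onorm ((*v) D)"
proof -
  have bl: "bounded_linear ((*v) D)" by simp
  have "\<bar>(D *v u) \<bullet> v\<bar> \<le> norm (D *v u)"
    using Cauchy_Schwarz_ineq2[of "D *v u" v] v by simp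
  also have "\<dots> \<le> onorm ((*v) D) * norm u" using onorm[OF bl] .
  also have "\<dots> \<le> onorm ((*v) D) * (c * (u \<bullet> v))"
    using c onorm_pos_le[OF bl] by (rule mult_left_mono)
  finally show ?thesis
    using inner_pos[OF C v(1) u] by (simp add: quasi_quotient_def field_simps abs_divide)
qed

section \<open>Upper estimates from an interior left quasi-eigenvector\<close>

text \<open>The quotients against \<open>v\<close> are bounded above, and \<open>v\<close> itself is
  an admissible \<open>u\<close>, so the supremum is finite. Density then carries its bound from the
  interior to all of \<open>C\<close>.\<close>

lemma left_quasi_eigenvector_finite:
  assumes C: "C \<in> punctured_cones" and l: "left_quasi_eigenvector C A v"
    and v: "v \<in> cone_interior C" "norm v = 1"
  obtains r where "lower_quasi_eigenvalue C A = ereal r"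
    "\<And>u. u \<in> C \<Longrightarrow> quasi_quotient A u v \<le> r"
proof -
  let ?L = "lower_quasi_eigenvalue C A"
  have ne: "C \<noteq> {}" using l by (auto simp: left_quasi_eigenvector_def)
  have L: "?L = (SUP u\<in>cone_interior C. ereal (quasi_quotient A u v))"
    using l by (simp add: left_quasi_eigenvector_def)
  obtain c where c: "\<And>u. u \<in> C \<Longrightarrow> norm u \<le> c * (u \<bullet> v)"
    using c1_finite[OF C ne v(1)] by blast
  have "\<bar>quasi_quotient A u v\<bar> \<le> c * onorm ((*v) A)" if "u \<in> C" for u
    using abs_quasi_quotient_le[OF C v that c[OF that]] .
  then have "?L \<le> ereal (c * onorm ((*v) A))"
    unfolding L using cone_interior_subset[OF C ne] by (intro SUP_least) force
  moreover have lb: "ereal (quasi_quotient A u v) \<le> ?L" if "u \<in> cone_interior C" for u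
    unfolding L using that by (rule SUP_upper)
  ultimately obtain r where r: "?L = ereal r"
    using lb[OF v(1)] by (cases ?L) auto
  show thesis
    using that[OF r] quasi_quotient_le_extend[OF C ne v(1)] lb unfolding r by simp
qed

text \<open>For every \<open>u\<close> the inner infimum is at most its value at the one fixed
  \<open>v\<close>.\<close>

lemma upper_quasi_eigenvalue_le:
  assumes v: "v \<in> cone_interior C" and le: "\<And>u. u \<in> C \<Longrightarrow> quasi_quotient B u v \<le> r"
  shows "upper_quasi_eigenvalue C B \<le> ereal r"
  unfolding upper_quasi_eigenvalue_def
  by (intro SUP_least INF_lower2[OF v]) (simp add: le)

lemma upper_stability:
  assumes C: "C \<in> punctured_cones" and l: "left_quasi_eigenvector C A v"
    and v: "v \<in> cone_interior C" "norm v = 1"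
  shows "upper_quasi_eigenvalue C (A + D) - lower_quasi_eigenvalue C A
      \<le> c1 C v * ereal (onorm ((*v) D))"
proof -
  have ne: "C \<noteq> {}" using l by (auto simp: left_quasi_eigenvector_def)
  obtain r where r: "lower_quasi_eigenvalue C A = ereal r"
    "\<And>u. u \<in> C \<Longrightarrow> quasi_quotient A u v \<le> r"
    using left_quasi_eigenvector_finite[OF C l v] by blast
  obtain c where c: "c1 C v = ereal c" "\<And>u. u \<in> C \<Longrightarrow> norm u \<le> c * (u \<bullet> v)"
    using c1_finite[OF C ne v(1)] by blast
  have "quasi_quotient (A + D) u v \<le> r + c * onorm ((*v) D)" if "u \<in> C" for u
    using r(2)[OF that] abs_quasi_quotient_le[OF C v that c(2)[OF that], of D]
    unfolding quasi_quotient_add by linarith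
  \<comment> \<open>The real bound excludes \<infinity> as the perturbed value; the value
    -\<infinity> would satisfy the claim trivially.\<close>
  from upper_quasi_eigenvalue_le[OF v(1) this] show ?thesis
    by (cases "upper_quasi_eigenvalue C (A + D)") (auto simp: r c)
qed

text \<open>A cone-nonpositive \<open>D\<close> contributes a nonpositive quotient, so the bound
  valid for \<open>A\<close> survives. The case \<open>D = 0\<close> later compares the two
  quasi-eigenvalues of \<open>A\<close> itself.\<close>

lemma upper_mono:
  assumes C: "C \<in> punctured_cones" and l: "left_quasi_eigenvector C A v"
    and v: "v \<in> cone_interior C" "norm v = 1" and D: "cone_nonpos C D"
  shows "upper_quasi_eigenvalue C (A + D) \<le> lower_quasi_eigenvalue C A"
proof -
  obtain r where r: "lower_quasi_eigenvalue C A = ereal r"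
    "\<And>u. u \<in> C \<Longrightarrow> quasi_quotient A u v \<le> r"
    using left_quasi_eigenvector_finite[OF C l v] by blast
  have "v \<in> C" using l by (simp add: left_quasi_eigenvector_def)
  then have "quasi_quotient D u v \<le> 0" if "u \<in> C" for u
    using D inner_pos[OF C v(1) that] that
    by (auto simp: cone_nonpos_def quasi_quotient_def divide_le_0_iff)
  then have "quasi_quotient (A + D) u v \<le> r" if "u \<in> C" for u
    using r(2) that by (fastforce simp: quasi_quotient_add)
  from upper_quasi_eigenvalue_le[OF v(1) this] show ?thesis by (simp add: r)
qed

section \<open>Duality by the negated transpose\<close>

lemma uminus_mult_vector: "(- A) *v u = - (A *v u)" for A :: "real ^ 'n ^ 'n"
  using matrix_vector_mult_diff_rdistrib[of 0 A u] by simp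

lemma vector_matrix_inner: "(u v* A) \<bullet> v = (A *v v) \<bullet> u" for A :: "real ^ 'n ^ 'n"
  unfolding dot_lmul_matrix by (rule inner_commute)

text \<open>Transposition swaps the two arguments and negation will swap suprema with infima;
  together they carry every upper estimate to a lower one.\<close>

lemma quasi_quotient_uminus_transpose:
  "quasi_quotient (- transpose B) u v = - quasi_quotient B v u"
  by (simp add: quasi_quotient_def uminus_mult_vector vector_matrix_inner inner_commute[of u v])

lemma upper_quasi_eigenvalue_uminus_transpose:
  "upper_quasi_eigenvalue C (- transpose B) = - lower_quasi_eigenvalue C B"
  unfolding upper_quasi_eigenvalue_def lower_quasi_eigenvalue_def quasi_quotient_uminus_transpose
    uminus_ereal.simps(1)[symmetric] ereal_SUP_uminus_eq ereal_INF_uminus_eq ..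

lemma lower_quasi_eigenvalue_uminus_transpose:
  "lower_quasi_eigenvalue C (- transpose B) = - upper_quasi_eigenvalue C B"
  unfolding upper_quasi_eigenvalue_def lower_quasi_eigenvalue_def quasi_quotient_uminus_transpose
    uminus_ereal.simps(1)[symmetric] ereal_SUP_uminus_eq ereal_INF_uminus_eq ..

lemma left_quasi_eigenvector_uminus_transpose:
  "left_quasi_eigenvector C (- transpose A) u \<longleftrightarrow> right_quasi_eigenvector C A u"
  unfolding left_quasi_eigenvector_def right_quasi_eigenvector_def
    lower_quasi_eigenvalue_uminus_transpose quasi_quotient_uminus_transpose
    uminus_ereal.simps(1)[symmetric] ereal_SUP_uminus_eq ereal_uminus_eq_iff ..

lemma cone_nonpos_uminus_transpose: "cone_nonpos C (- transpose D) \<longleftrightarrow> cone_nonneg C D"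
  by (auto simp: cone_nonpos_def cone_nonneg_def uminus_mult_vector vector_matrix_inner)

lemma uminus_transpose_add: "- transpose (A + D) = - transpose A - transpose D"
  for A D :: "real ^ 'n ^ 'n"
  by (simp add: transpose_def vec_eq_iff)

text \<open>With \<open>y\<close> the image of \<open>x\<close> under the transpose, the square of
  \<open>norm y\<close> is the inner product of \<open>D *v y\<close> with \<open>x\<close>. Bound
  it by Cauchy-Schwarz and the norm of \<open>D\<close>, then cancel \<open>norm y\<close> unless it
  vanishes.\<close>

lemma onorm_transpose_le: "onorm ((*v) (transpose D)) \<le> onorm ((*v) D)"
  for D :: "real ^ 'n ^ 'n"
proof (rule onorm_le)
  fix x
  let ?y = "transpose D *v x"
  have "norm ?y * norm ?y = (D *v ?y) \<bullet> x"
    by (simp add: power2_norm_eq_inner power2_eq_square[symmetric] dot_lmul_matrix inner_commute)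
  also have "\<dots> \<le> norm (D *v ?y) * norm x" by (rule norm_cauchy_schwarz)
  also have "\<dots> \<le> (onorm ((*v) D) * norm ?y) * norm x"
    by (intro mult_right_mono onorm) auto
  finally have "norm ?y * norm ?y \<le> norm ?y * (onorm ((*v) D) * norm x)"
    by (simp add: mult_ac)
  then show "norm ?y \<le> onorm ((*v) D) * norm x"
    by (cases "norm ?y = 0") (auto simp: onorm_pos_le)
qed

lemma onorm_uminus_transpose: "onorm ((*v) (- transpose D)) = onorm ((*v) D)"
  for D :: "real ^ 'n ^ 'n"
proof -
  have "onorm (\<lambda>x. (- transpose D) *v x) = onorm ((*v) (transpose D))"
    unfolding uminus_mult_vector by (rule onorm_neg)
  also have "\<dots> = onorm ((*v) D)"
    using onorm_transpose_le[of D] onorm_transpose_le[of "transpose D"] by simp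
  finally show ?thesis .
qed

lemma c2_eq_c1: "c2 C u = c1 C u"
  by (simp add: c1_def c2_def inner_commute)

section \<open>Lower estimates by duality\<close>

lemma right_quasi_eigenvector_finite:
  assumes C: "C \<in> punctured_cones" and r: "right_quasi_eigenvector C A u"
    and u: "u \<in> cone_interior C" "norm u = 1"
  obtains x where "upper_quasi_eigenvalue C A = ereal x"
proof -
  obtain y where "- upper_quasi_eigenvalue C A = ereal y"
    using left_quasi_eigenvector_finite[OF C _ u, of "- transpose A"] r
    by (auto simp: left_quasi_eigenvector_uminus_transpose lower_quasi_eigenvalue_uminus_transpose)
  then show thesis using that by (cases "upper_quasi_eigenvalue C A") auto
qed

lemma lower_stability:
  assumes C: "C \<in> punctured_cones" and r: "right_quasi_eigenvector C A u"
    and u: "u \<in> cone_interior C" "norm u = 1"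
  shows "- c2 C u * ereal (onorm ((*v) D))
      \<le> lower_quasi_eigenvalue C (A + D) - upper_quasi_eigenvalue C A"
proof -
  have "- lower_quasi_eigenvalue C (A + D) - - upper_quasi_eigenvalue C A
      \<le> c2 C u * ereal (onorm ((*v) D))"
    using upper_stability[OF C _ u, of "- transpose A" "- transpose D"] r
    by (simp add: left_quasi_eigenvector_uminus_transpose onorm_uminus_transpose c2_eq_c1
        lower_quasi_eigenvalue_uminus_transpose upper_quasi_eigenvalue_uminus_transpose
        flip: uminus_transpose_add)
  \<comment> \<open>Finiteness of the value at \<open>A\<close> and of the constant justifies moving
    the signs across the inequality in \<open>ereal\<close>.\<close>
  moreover obtain x where "upper_quasi_eigenvalue C A = ereal x"
    using right_quasi_eigenvector_finite[OF C r u] by blast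
  moreover have "C \<noteq> {}" using r by (auto simp: right_quasi_eigenvector_def)
  then obtain c where "c2 C u = ereal c"
    unfolding c2_eq_c1 by (rule c1_finite[OF C _ u(1)])
  ultimately show ?thesis
    by (cases "lower_quasi_eigenvalue C (A + D)") auto
qed

lemma lower_mono:
  assumes C: "C \<in> punctured_cones" and r: "right_quasi_eigenvector C A u"
    and u: "u \<in> cone_interior C" "norm u = 1" and D: "cone_nonneg C D"
  shows "upper_quasi_eigenvalue C A \<le> lower_quasi_eigenvalue C (A + D)"
proof -
  have "- lower_quasi_eigenvalue C (A + D) \<le> - upper_quasi_eigenvalue C A"
    using upper_mono[OF C _ u, of "- transpose A" "- transpose D"] r D
    by (simp add: left_quasi_eigenvector_uminus_transpose cone_nonpos_uminus_transpose
        lower_quasi_eigenvalue_uminus_transpose upper_quasi_eigenvalue_uminus_transpose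
        flip: uminus_transpose_add)
  then show ?thesis by simp
qed

section \<open>Theorem of the alternative and minimax inequality\<close>

text \<open>Compactness of the base makes the separation from the closed cone strict, and
  self-duality puts the separating normal back into the cone.\<close>

lemma cone_alternative:
  fixes B :: "real ^ 'n ^ 'n"
  assumes C: "C \<in> punctured_cones" and ne: "C \<noteq> {}"
    and none: "\<And>u. u \<in> C \<Longrightarrow> B *v u \<notin> insert 0 C"
  obtains w where "w \<in> C" "\<And>u. u \<in> C \<Longrightarrow> (B *v u) \<bullet> w < 0"
proof -
  obtain v where v: "v \<in> cone_interior C"
    using cone_interior_nonempty[OF C] by blast
  obtain e where e: "0 < e" "\<And>u. u \<in> insert 0 C \<Longrightarrow> e * norm u \<le> u \<bullet> v"
    using interior_inner_bound[OF C v] by blast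
  \<comment> \<open>Every ray of \<open>C\<close> meets this slice because \<open>v\<close> is
    positive on \<open>C\<close>; on the slice the uniform bound reads
    \<open>e * norm u \<le> 1\<close>.\<close>
  define S where "S = insert 0 C \<inter> {u. v \<bullet> u = 1}"
  have scale: "(1 / (u \<bullet> v)) *\<^sub>R u \<in> S" if "u \<in> C" for u
  proof -
    have "0 < u \<bullet> v" using inner_pos[OF C v that] .
    moreover from this have "(1 / (u \<bullet> v)) *\<^sub>R u \<in> insert 0 C"
      using that by (intro cone_scale[OF C]) auto
    ultimately show ?thesis by (simp only: S_def Int_iff mem_Collect_eq) (simp add: inner_commute)
  qed
  have "closed S" unfolding S_def
    by (intro closed_Int closed_hyperplane cone_closed[OF C])
  moreover have "norm u \<le> 1 / e" if "u \<in> S" for u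
    using that e(1) e(2)[of u] unfolding S_def by (simp add: field_simps inner_commute)
  then have "bounded S" by (auto simp: bounded_iff)
  ultimately have "compact S" by (simp add: compact_eq_bounded_closed)
  then have "compact ((*v) B ` S)"
    by (intro compact_continuous_image linear_continuous_on) simp_all
  moreover have "convex S" unfolding S_def
    by (intro convex_Int convex_hyperplane cone_convex[OF C])
  then have "convex ((*v) B ` S)" by (intro convex_linear_image) simp_all
  moreover have "S \<noteq> {}" using scale ne by blast
  then have "(*v) B ` S \<noteq> {}" by simp
  moreover have "S \<subseteq> C" by (auto simp: S_def)
  then have "(*v) B ` S \<inter> insert 0 C = {}" using none by blast
  ultimately obtain w b where neg: "\<And>x. x \<in> S \<Longrightarrow> w \<bullet> (B *v x) < b"
    and pos: "\<And>x. x \<in> insert 0 C \<Longrightarrow> b < w \<bullet> x"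
    using separating_hyperplane_compact_closed[OF _ _ _ cone_convex[OF C] cone_closed[OF C],
        of "(*v) B ` S"]
    by blast
  \<comment> \<open>The closed cone contains 0, so the separating level is negative and
    \<open>w\<close> is negative on the whole image of \<open>S\<close>.\<close>
  have b: "b < 0" using pos[of 0] by simp
  \<comment> \<open>A linear function bounded below on a cone is nonnegative there.\<close>
  have "0 \<le> x \<bullet> w" if "x \<in> insert 0 C" for x
  proof (rule ccontr)
    assume "\<not> 0 \<le> x \<bullet> w"
    then have neg: "w \<bullet> x < 0" by (simp add: inner_commute)
    \<comment> \<open>The factor, a quotient of two negative numbers, makes the inner product with
      \<open>w\<close> exactly \<open>b\<close>, against strict separation.\<close>
    with b have "(b / (w \<bullet> x)) *\<^sub>R x \<in> insert 0 C"
      using that by (intro cone_scale[OF C]) (auto simp: divide_nonpos_neg)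
    from pos[OF this] neg show False by simp
  qed
  then have wK: "w \<in> insert 0 C" using cone_self_dual[OF C] by blast
  have "(B *v u) \<bullet> w < 0" if "u \<in> C" for u
  proof -
    have "(1 / (u \<bullet> v)) * (w \<bullet> (B *v u)) < 0"
      using neg[OF scale[OF that]] b by (simp add: matrix_vector_mult_scaleR)
    then show ?thesis using inner_pos[OF C v that]
      by (simp add: inner_commute divide_less_0_iff)
  qed
  moreover from this have "w \<noteq> 0" using ne by fastforce
  ultimately show thesis using that wK by blast
qed

text \<open>This is the minimax direction that rests on separation. If it failed, take
  \<open>r\<close> strictly between: a \<open>u\<close> with \<open>(B - r)u\<close> in the closed
  cone forces the upper value to be at least \<open>r\<close>, and the \<open>w\<close> of the
  alternative forces the lower value to be at most \<open>r\<close>.\<close>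

lemma lower_le_upper:
  assumes C: "C \<in> punctured_cones" and ne: "C \<noteq> {}"
  shows "lower_quasi_eigenvalue C B \<le> upper_quasi_eigenvalue C B"
proof (rule ccontr)
  assume "\<not> ?thesis"
  then obtain r where r: "upper_quasi_eigenvalue C B < ereal r" "ereal r < lower_quasi_eigenvalue C B"
    using ereal_dense2 by (metis not_le)
  \<comment> \<open>The shift turns comparison of the quotient with \<open>r\<close> into the sign
    of a numerator.\<close>
  let ?B = "B - r *\<^sub>R mat 1"
  have B: "(?B *v u) \<bullet> v = (B *v u) \<bullet> v - r * (u \<bullet> v)" for u v
    by (simp add: matrix_vector_mult_diff_rdistrib inner_diff_left scaleR_matrix_vector_assoc[symmetric])
  note sub = cone_interior_subset[OF C ne]
  have "?B *v u \<notin> insert 0 C" if u: "u \<in> C" for u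
  proof
    assume *: "?B *v u \<in> insert 0 C"
    have "r \<le> quasi_quotient B u v" if v: "v \<in> cone_interior C" for v
    proof -
      have "0 \<le> v \<bullet> (?B *v u)"
        using * sub v by (intro cone_inner_nonneg[OF C]) auto
      then show ?thesis using inner_pos[OF C v u] B[of u v]
        by (simp add: quasi_quotient_def field_simps inner_commute)
    qed
    then have "ereal r \<le> (INF v\<in>cone_interior C. ereal (quasi_quotient B u v))"
      by (intro INF_greatest) simp
    also have "\<dots> \<le> upper_quasi_eigenvalue C B"
      unfolding upper_quasi_eigenvalue_def using u by (rule SUP_upper)
    finally show False using r by simp
  qed
  then obtain w where w: "w \<in> C" "\<And>u. u \<in> C \<Longrightarrow> (?B *v u) \<bullet> w < 0"
    using cone_alternative[OF C ne] by blast
  have "quasi_quotient B u w \<le> r" if u: "u \<in> cone_interior C" for u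
  proof -
    have "(?B *v u) \<bullet> w < 0" using w sub u by blast
    then show ?thesis using inner_pos[OF C u w(1)] B[of u w]
      by (simp add: quasi_quotient_def field_simps inner_commute)
  qed
  then have "(SUP u\<in>cone_interior C. ereal (quasi_quotient B u w)) \<le> ereal r"
    by (intro SUP_least) simp
  moreover have "lower_quasi_eigenvalue C B \<le> (SUP u\<in>cone_interior C. ereal (quasi_quotient B u w))"
    unfolding lower_quasi_eigenvalue_def using w(1) by (rule INF_lower)
  ultimately show False using r by simp
qed

section \<open>Two-sided estimates\<close>

lemma two_sided_stability:
  assumes C: "C \<in> punctured_cones"
    and r: "right_quasi_eigenvector C A u" and u: "u \<in> cone_interior C" "norm u = 1"
    and l: "left_quasi_eigenvector C A v" and v: "v \<in> cone_interior C" "norm v = 1"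
  shows "\<bar>upper_quasi_eigenvalue C (A + D) - quasi_eigenvalue C A\<bar>
           \<le> c0 C u v * ereal (onorm ((*v) D))" (is ?upper)
    and "\<bar>lower_quasi_eigenvalue C (A + D) - quasi_eigenvalue C A\<bar>
           \<le> c0 C u v * ereal (onorm ((*v) D))" (is ?lower)
proof -
  have ne: "C \<noteq> {}" using r by (auto simp: right_quasi_eigenvector_def)
  \<comment> \<open>The zero perturbation gives one inequality and minimax the other, so the
    definite description in \<open>quasi_eigenvalue\<close> denotes the common value.\<close>
  have "upper_quasi_eigenvalue C A \<le> lower_quasi_eigenvalue C A"
    using upper_mono[OF C l v, of 0] by (simp add: cone_nonpos_def)
  then have eq: "lower_quasi_eigenvalue C A = upper_quasi_eigenvalue C A"
    using lower_le_upper[OF C ne] by (simp add: antisym)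
  then have q: "quasi_eigenvalue C A = upper_quasi_eigenvalue C A"
    by (simp add: quasi_eigenvalue_def)
  obtain x where x: "upper_quasi_eigenvalue C A = ereal x"
    using right_quasi_eigenvector_finite[OF C r u] by blast
  obtain a b where ab: "c1 C v = ereal a" "c2 C u = ereal b"
    unfolding c2_eq_c1 by (rule c1_finite[OF C ne u(1)], rule c1_finite[OF C ne v(1)]) blast
  define d where "d = onorm ((*v) D)"
  have "0 \<le> d" unfolding d_def by (intro onorm_pos_le) simp
  then have m: "a * d \<le> max a b * d" "b * d \<le> max a b * d"
    by (simp_all add: mult_right_mono)
  have c0: "c0 C u v * ereal d = ereal (max a b * d)"
    by (simp add: c0_def ab max_def)
  have up: "upper_quasi_eigenvalue C (A + D) - ereal x \<le> ereal (a * d)"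
    using upper_stability[OF C l v, of D] by (simp add: eq x ab d_def)
  have lo: "ereal (- (b * d)) \<le> lower_quasi_eigenvalue C (A + D) - ereal x"
    using lower_stability[OF C r u, of D] by (simp add: x ab d_def)
  have le: "lower_quasi_eigenvalue C (A + D) \<le> upper_quasi_eigenvalue C (A + D)"
    using lower_le_upper[OF C ne] .
  \<comment> \<open>The lower value lies below the upper one, so a lower bound on the former and an
    upper bound on the latter confine both to the reals, and each bound serves both values.\<close>
  obtain p where p: "upper_quasi_eigenvalue C (A + D) = ereal p"
    using up lo le
    by (cases "upper_quasi_eigenvalue C (A + D)"; cases "lower_quasi_eigenvalue C (A + D)") auto
  obtain s where s: "lower_quasi_eigenvalue C (A + D) = ereal s"
    using lo le p by (cases "lower_quasi_eigenvalue C (A + D)") auto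
  have "p - x \<le> a * d" "- (b * d) \<le> s - x" "s \<le> p"
    using up lo le by (simp_all add: p s)
  with m have "\<bar>p - x\<bar> \<le> max a b * d" "\<bar>s - x\<bar> \<le> max a b * d"
    by linarith+
  then show ?upper ?lower
    unfolding q x p s d_def[symmetric] c0 by simp_all
qed

theorem theorem1p2:
  fixes A :: "real ^ 'n ^ 'n" and C :: "(real ^ 'n) set" and u\<^sub>C v\<^sub>C :: "real ^ 'n"
  assumes "C \<in> punctured_cones"
    and "right_quasi_eigenvector C A u\<^sub>C" and "norm u\<^sub>C = 1"
    and "left_quasi_eigenvector C A v\<^sub>C" and "norm v\<^sub>C = 1"
  shows
    "(v\<^sub>C \<in> cone_interior C \<longrightarrow>
        c1 C v\<^sub>C < \<infinity> \<and>
        (\<forall>D. upper_quasi_eigenvalue C (A + D) - lower_quasi_eigenvalue C A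
               \<le> c1 C v\<^sub>C * ereal (onorm ((*v) D))) \<and>
        (\<forall>D. cone_nonpos C D \<longrightarrow>
               upper_quasi_eigenvalue C (A + D) \<le> lower_quasi_eigenvalue C A) \<and>
        (C = positive_orthant \<longrightarrow> (\<forall>D. entrywise_nonpos D \<longrightarrow>
               upper_quasi_eigenvalue C (A + D) \<le> lower_quasi_eigenvalue C A))) \<and>
     (u\<^sub>C \<in> cone_interior C \<longrightarrow>
        c2 C u\<^sub>C < \<infinity> \<and>
        (\<forall>D. lower_quasi_eigenvalue C (A + D) - upper_quasi_eigenvalue C A
               \<ge> - (c2 C u\<^sub>C) * ereal (onorm ((*v) D))) \<and>
        (\<forall>D. cone_nonneg C D \<longrightarrow>
               lower_quasi_eigenvalue C (A + D) \<ge> upper_quasi_eigenvalue C A) \<and>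
        (C = positive_orthant \<longrightarrow> (\<forall>D. entrywise_nonneg D \<longrightarrow>
               lower_quasi_eigenvalue C (A + D) \<ge> upper_quasi_eigenvalue C A))) \<and>
     (u\<^sub>C \<in> cone_interior C \<and> v\<^sub>C \<in> cone_interior C \<longrightarrow>
        (\<forall>D. \<bar>upper_quasi_eigenvalue C (A + D) - quasi_eigenvalue C A\<bar>
               \<le> c0 C u\<^sub>C v\<^sub>C * ereal (onorm ((*v) D)) \<and>
             \<bar>lower_quasi_eigenvalue C (A + D) - quasi_eigenvalue C A\<bar>
               \<le> c0 C u\<^sub>C v\<^sub>C * ereal (onorm ((*v) D))))"
proof -
  note C = assms(1) and r = assms(2) and u = assms(3) and l = assms(4) and v = assms(5)
  have ne: "C \<noteq> {}" using r by (auto simp: right_quasi_eigenvector_def)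
  have fin: "c1 C x < \<infinity>" "c2 C x < \<infinity>" if x: "x \<in> cone_interior C" for x
  proof -
    obtain c where "c1 C x = ereal c" by (rule c1_finite[OF C ne x])
    then show "c1 C x < \<infinity>" "c2 C x < \<infinity>" by (simp_all add: c2_eq_c1)
  qed
  show ?thesis
  proof (intro conjI impI allI)
    assume vC: "v\<^sub>C \<in> cone_interior C"
    show "c1 C v\<^sub>C < \<infinity>" by (rule fin[OF vC])
    show "upper_quasi_eigenvalue C (A + D) - lower_quasi_eigenvalue C A
        \<le> c1 C v\<^sub>C * ereal (onorm ((*v) D))" for D
      by (rule upper_stability[OF C l vC v])
    show "upper_quasi_eigenvalue C (A + D) \<le> lower_quasi_eigenvalue C A"
      if "cone_nonpos C D" for D
      by (rule upper_mono[OF C l vC v that])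
    \<comment> \<open>On the orthant the entrywise sign condition is the one induced by the
      cone.\<close>
    show "upper_quasi_eigenvalue C (A + D) \<le> lower_quasi_eigenvalue C A"
      if "C = positive_orthant" "entrywise_nonpos D" for D
      using upper_mono[OF C l vC v] that cone_nonpos_orthant_iff by blast
  next
    assume uC: "u\<^sub>C \<in> cone_interior C"
    show "c2 C u\<^sub>C < \<infinity>" by (rule fin[OF uC])
    show "- (c2 C u\<^sub>C) * ereal (onorm ((*v) D))
        \<le> lower_quasi_eigenvalue C (A + D) - upper_quasi_eigenvalue C A" for D
      by (rule lower_stability[OF C r uC u])
    show "upper_quasi_eigenvalue C A \<le> lower_quasi_eigenvalue C (A + D)"
      if "cone_nonneg C D" for D
      by (rule lower_mono[OF C r uC u that])
    show "upper_quasi_eigenvalue C A \<le> lower_quasi_eigenvalue C (A + D)"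
      if "C = positive_orthant" "entrywise_nonneg D" for D
      using lower_mono[OF C r uC u] that cone_nonneg_orthant_iff by blast
  next
    fix D
    assume "u\<^sub>C \<in> cone_interior C \<and> v\<^sub>C \<in> cone_interior C"
    then have uC: "u\<^sub>C \<in> cone_interior C" and vC: "v\<^sub>C \<in> cone_interior C" by simp_all
    show "\<bar>upper_quasi_eigenvalue C (A + D) - quasi_eigenvalue C A\<bar>
          \<le> c0 C u\<^sub>C v\<^sub>C * ereal (onorm ((*v) D))"
      "\<bar>lower_quasi_eigenvalue C (A + D) - quasi_eigenvalue C A\<bar>
          \<le> c0 C u\<^sub>C v\<^sub>C * ereal (onorm ((*v) D))"
      by (rule two_sided_stability[OF C r uC u l vC v])+
  qed
qed

end
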